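(* Let $q\in C[-b,b]$ be complex valued, let $f$ be a solution of $f''=qf$ on $[-b,b]$ with $f\neq0$ on $[-b,b]$, $f(0)=1$, and $h:=f'(0)$. Let $\mathbf{K}$ be the transmutation kernel associated with $q$ and $h$, and let $\mathbf{k}:=\mathbf{T}_f^{-1}[\mathbf{K}]$ be its preimage, i.e. $\mathbf{k}(x,\tau)=\mathbf{K}(x,\tau)-\int_{-x}^{x}\mathbf{K}(t,x)\mathbf{K}(t,\tau)\,dt$ for $(x,\tau)\in[-b,b]^2$. Then $$\mathbf{k}(x,\tau)=\frac h2+\frac12\int_0^{\frac{x+\tau}2}q(s)\,ds-\int_{-\frac{x+\tau}2}^{\frac{x+\tau}2}\mathbf{K}^2\left(t,\frac{x+\tau}2\right)dt-\int_{-\frac{x-\tau}2}^{\frac{x-\tau}2}\mathbf{K}\left(t,\frac{x-\tau}2\right)\mathbf{K}\left(t,-\frac{x-\tau}2\right)dt .$$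
   Context: The kernel is $\mathbf{K}(x,t)=\mathbf{H}\big(\frac{x+t}{2},\frac{x-t}{2}\big)$ for $(x,t)\in\overline{\mathbf{S}}=[-b,b]\times[-b,b]$, where $\mathbf{H}$ is the unique solution of the Goursat problem $\frac{\partial^2\mathbf{H}(u,v)}{\partial u\,\partial v}=q(u+v)\mathbf{H}(u,v)$, $\mathbf{H}(u,0)=\frac h2+\frac12\int_0^u q(s)\,ds$, $\mathbf{H}(0,v)=\frac h2$; equivalently, $\mathbf{H}(u,v)=\frac h2+\frac12\int_0^u q(s)\,ds+\int_0^u\int_0^v q(\alpha+\beta)\mathbf{H}(\alpha,\beta)\,d\beta\,d\alpha$. The transmutation operator is $\mathbf{T}_fu(x)=u(x)+\int_{-x}^x\mathbf{K}(x,t)u(t)\,dt$ on $C[-b,b]$, and its inverse is $\mathbf{T}_f^{-1}u(x)=u(x)-\int_{-x}^x\mathbf{K}(t,x)u(t)\,dt$; in the definition of $\mathbf{k}$ it acts on $\mathbf{K}(\cdot,\tau)$ with $\tau$ fixed. *)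

theory Defs
  imports "HOL-Analysis.Analysis"
begin

text \<open>
  All integrals below are oriented (\<open>LBINT s=a..b. _\<close> changes sign when \<open>a\<close> and \<open>b\<close> are
  swapped), since the arguments \<open>x\<close>, \<open>u\<close>, \<open>v\<close> may be negative.

  The substitution \<open>x = u + v\<close>, \<open>t = u - v\<close> carries the diamond onto the square \<open>[-b,b] \<times> [-b,b]\<close>;
  \<open>q (u + v)\<close> is only evaluated inside \<open>[-b,b]\<close>.
\<close>

definition diamond :: "real \<Rightarrow> (real \<times> real) set" where
  "diamond b = {(u, v). \<bar>u\<bar> + \<bar>v\<bar> \<le> b}"

text \<open>
  \<open>Hv\<close> is the partial derivative of \<open>H\<close> in \<open>v\<close>, so that the derivative of \<open>Hv\<close> in \<open>u\<close> is the mixed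
  derivative. The equation is required in the open diamond; \<open>H\<close> is continuous up to the boundary
  (at the corners of the closed diamond one of the partial derivatives has no meaning).
\<close>

definition goursat_solution ::
    "real \<Rightarrow> (real \<Rightarrow> complex) \<Rightarrow> complex \<Rightarrow> (real \<Rightarrow> real \<Rightarrow> complex) \<Rightarrow> bool" where
  "goursat_solution b q h H \<longleftrightarrow>
     continuous_on (diamond b) (\<lambda>(u, v). H u v) \<and>
     (\<exists>Hv. \<forall>u v. \<bar>u\<bar> + \<bar>v\<bar> < b \<longrightarrow>
        ((\<lambda>v'. H u v') has_vector_derivative Hv u v) (at v) \<and>
        ((\<lambda>u'. Hv u' v) has_vector_derivative q (u + v) * H u v) (at u)) \<and>
     (\<forall>u\<in>{-b..b}. H u 0 = h / 2 + 1 / 2 * (LBINT s=0..u. q s)) \<and>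
     (\<forall>v\<in>{-b..b}. H 0 v = h / 2)"

definition transmutation_kernel ::
    "real \<Rightarrow> (real \<Rightarrow> complex) \<Rightarrow> complex \<Rightarrow> (real \<Rightarrow> real \<Rightarrow> complex) \<Rightarrow> bool" where
  "transmutation_kernel b q h K \<longleftrightarrow>
     (\<exists>H. goursat_solution b q h H \<and>
        (\<forall>x\<in>{-b..b}. \<forall>t\<in>{-b..b}. K x t = H ((x + t) / 2) ((x - t) / 2)))"

text \<open>
  The inverse of \<open>u \<mapsto> (\<lambda>x. u x + (LBINT t=-x..x. K x t * u t))\<close>; note the swapped arguments of \<open>K\<close>.
\<close>

definition inv_transmutation ::
    "(real \<Rightarrow> real \<Rightarrow> complex) \<Rightarrow> (real \<Rightarrow> complex) \<Rightarrow> real \<Rightarrow> complex" where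
  "inv_transmutation K u x = u x - (LBINT t=-x..x. K t x * u t)"

definition kernel_preimage ::
    "(real \<Rightarrow> real \<Rightarrow> complex) \<Rightarrow> real \<Rightarrow> real \<Rightarrow> complex" where
  "kernel_preimage K x \<tau> = inv_transmutation K (\<lambda>s. K s \<tau>) x"

end

theory Submission
  imports Defs
begin

text \<open>
  In the characteristic coordinates \<open>u = (x + \<tau>) / 2\<close>, \<open>v = (x - \<tau>) / 2\<close> the claim says that the
  preimage \<open>k\<close> is the sum of a function of \<open>u\<close> and a function of \<open>v\<close>, that is, that \<open>k\<close> solves the
  wave equation without potential; the two summands are then read off on the axes \<open>v = 0\<close> and
  \<open>u = 0\<close>. Write \<open>J u v\<close> for the integral of \<open>K t x * K t \<tau>\<close> over \<open>t\<close> from \<open>-x\<close> to \<open>x\<close>, so that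
  \<open>k = H - J\<close> for the Goursat solution \<open>H\<close>. It suffices that the mixed derivative of \<open>J\<close> is
  \<open>q (u + v) * H u v\<close>, the same as that of \<open>H\<close>.

  For smooth \<open>q\<close> this is Green's formula for \<open>\<lambda>t. K t x\<close> and \<open>\<lambda>t. K t \<tau>\<close>, but for merely
  continuous \<open>q\<close> the function \<open>H\<close> has only one second derivative, the mixed one. The proof
  therefore differentiates \<open>J\<close> so that no other second derivative appears. With \<open>t = x - 2 * c\<close>,
  \<open>J u v\<close> is twice the integral over \<open>c\<close> from \<open>0\<close> to \<open>u + v\<close> of
  \<open>H (u + v - c) (-c) * H (u - c) (v - c)\<close>. Its \<open>u\<close>-derivative has two integral terms with the factor
  \<open>U\<close>, the derivative of \<open>H\<close> in its first argument, and \<open>U\<close> may be differentiated only in its second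
  argument. In the first term, \<open>v\<close> enters \<open>U (u - c) (v - c)\<close> in the right place; the other term is
  first reflected by \<open>c = u + v - a\<close>, which turns its factor into \<open>U a (a - u - v)\<close>. In the sum of
  the two \<open>v\<close>-derivatives the products \<open>U * U\<close> cancel; so do the terms with the mixed derivative
  \<open>w = q * H\<close>, because \<open>q\<close> is evaluated at the same point \<open>t\<close> in both factors; and the boundary
  terms at the characteristic \<open>u = 0\<close> cancel because \<open>H\<close> is constant there. What remains is
  \<open>2 * U (u + v) 0 * H u v\<close>, and \<open>2 * U x 0 = q x\<close> by the data on \<open>v = 0\<close>. The computation is
  \<open>mixed_derivative.kernel_product_u_deriv\<close>, and integrating back, first in \<open>v\<close> and then in \<open>u\<close>, gives
  \<open>mixed_derivative.kernel_product_additive\<close>.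

  All this differentiation would be awkward at the boundary of the diamond. So
  \<open>goursat_extension\<close> replaces \<open>H\<close> by a function on the whole plane that has all the derivatives
  used; it satisfies the differential equation only in the diamond, which is where the
  cancellation takes place.
\<close>

section \<open>Oriented integrals with parameters and moving endpoints\<close>

lemma continuous_on_two_args:
  assumes "continuous_on UNIV (\<lambda>z. f (fst z) (snd z))" "continuous_on S a" "continuous_on S b"
  shows "continuous_on S (\<lambda>x. f (a x) (b x))"
  using continuous_on_compose2[OF assms(1) continuous_on_Pair[OF assms(2,3)]] by simp

lemma has_vector_derivative_chain_real:
  assumes "(F has_vector_derivative F') (at (l s))" "(l has_real_derivative l') (at s)"
  shows "((\<lambda>s. F (l s)) has_vector_derivative l' *\<^sub>R F') (at s)"
  using vector_diff_chain_at[where f=l and g=F, OF _ assms(1)] assms(2)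
  by (simp add: o_def has_real_derivative_iff_has_vector_derivative)

lemma has_vector_derivative_zero_on_segment:
  fixes \<phi> :: "real \<Rightarrow> 'a::real_normed_vector"
  assumes "\<And>t. t \<in> closed_segment 0 u \<Longrightarrow> (\<phi> has_vector_derivative 0) (at t)"
  shows "\<phi> u = \<phi> 0"
  using has_derivative_zero_unique[of "closed_segment 0 u" \<phi> u 0] assms
  by (simp add: has_vector_derivative_def has_derivative_at_withinI)

lemma interval_integral_has_vector_derivative:
  fixes g :: "real \<Rightarrow> 'a::euclidean_space" and c y :: real
  assumes g: "continuous_on UNIV g"
  shows "((\<lambda>y. LBINT a=c..y. g a) has_vector_derivative g y) (at y)"
proof -
  define R where "R = \<bar>c\<bar> + \<bar>y\<bar> + 1"
  have R: "-R \<le> c" "c \<le> R" "-R < y" "y < R" unfolding R_def by linarith+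
  have "((\<lambda>y. LBINT a=c..y. g a) has_vector_derivative g y) (at y within {-R..R})"
    using R by (intro interval_integral_FTC2 continuous_on_subset[OF g]) auto
  then show ?thesis using R by (simp add: at_within_Icc_at)
qed

text \<open>
  With oriented integrals this covers scaling by either sign, the reflection of an interval, and the
  change of variable \<open>t = x - 2 * c\<close>.
\<close>

lemma interval_integral_affine:
  fixes g :: "real \<Rightarrow> 'a::euclidean_space" and m c a b :: real
  assumes g: "continuous_on UNIV g"
  shows "(LBINT t=(m * a + c)..(m * b + c). g t) = m *\<^sub>R (LBINT s=a..b. g (m * s + c))"
proof -
  define F where "F = (\<lambda>y::real. LBINT t=(0::real)..y. g t)"
  have F: "(F has_vector_derivative g y) (at y)" for y
    unfolding F_def by (rule interval_integral_has_vector_derivative[OF g])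
  have Fm: "((\<lambda>s. F (m * s + c)) has_vector_derivative m *\<^sub>R g (m * s + c)) (at s)" for s
    by (rule has_vector_derivative_chain_real[OF F]) (auto intro!: derivative_eq_intros)
  have "(LBINT s=a..b. m *\<^sub>R g (m * s + c)) = F (m * b + c) - F (m * a + c)"
    by (rule interval_integral_FTC_finite)
      (auto intro!: continuous_intros continuous_on_compose2[OF g]
        has_vector_derivative_at_within Fm)
  moreover have "(LBINT t=(m * a + c)..(m * b + c). g t) = F (m * b + c) - F (m * a + c)"
    by (rule interval_integral_FTC_finite)
      (auto intro!: has_vector_derivative_at_within F continuous_on_subset[OF g])
  moreover have "(LBINT s=a..b. m *\<^sub>R g (m * s + c)) = m *\<^sub>R (LBINT s=a..b. g (m * s + c))"
    by (simp add: interval_lebesgue_integral_def)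
  ultimately show ?thesis by simp
qed

text \<open>
  Moving the endpoint into the integrand leaves an integral over a fixed interval, for which
  continuity in parameters and differentiation under the integral sign are standard.
\<close>

lemma interval_integral_rescaled:
  fixes g :: "real \<Rightarrow> 'a::euclidean_space" and y :: real
  assumes g: "continuous_on UNIV g"
  shows "(LBINT a=0..y. g a) = y *\<^sub>R integral {0..1} (\<lambda>s. g (y * s))"
proof -
  have "(LBINT a=0..y. g a) = y *\<^sub>R (LBINT s=(0::real)..(1::real). g (y * s))"
    using interval_integral_affine[OF g, of y 0 0 1] by (simp add: zero_ereal_def)
  also have "(LBINT s=(0::real)..(1::real). g (y * s)) = integral {0..1} (\<lambda>s. g (y * s))"
    by (rule interval_integral_eq_integral)
      (auto intro!: borel_integrable_atLeastAtMost' continuous_intros continuous_on_compose2[OF g])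
  finally show ?thesis .
qed

lemma interval_integral_continuous_param:
  fixes g :: "'p::metric_space \<Rightarrow> real \<Rightarrow> 'a::euclidean_space"
  assumes g: "continuous_on UNIV (\<lambda>z. g (fst z) (snd z))"
  shows "continuous_on UNIV (\<lambda>z. LBINT a=0..ereal (snd z). g (fst z) a)"
proof -
  have gp: "continuous_on UNIV (g p)" for p
    using continuous_on_two_args[OF g, of UNIV "\<lambda>_. p" "\<lambda>a. a"] by (simp add: continuous_intros)
  have "continuous_on UNIV (\<lambda>z. snd z *\<^sub>R integral (cbox 0 1) (\<lambda>s. g (fst z) (snd z * s)))"
    by (intro continuous_intros integral_continuous_on_param)
      (auto simp: split_beta intro!: continuous_intros continuous_on_two_args[OF g])
  then show ?thesis
    using interval_integral_rescaled[OF gp] by (simp add: cbox_interval)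
qed

text \<open>
  As a function of the parameter and the endpoint separately, the integral has one partial
  derivative by the Leibniz rule for fixed limits and the other by the fundamental theorem of
  calculus; the latter is jointly continuous, so the integral is differentiable in both variables
  together and the chain rule applies along the curve \<open>s \<mapsto> (s, l s)\<close>.
\<close>

lemma leibniz_moving_endpoint:
  fixes g g' :: "real \<Rightarrow> real \<Rightarrow> 'a::euclidean_space" and l :: "real \<Rightarrow> real"
  assumes g: "continuous_on UNIV (\<lambda>z. g (fst z) (snd z))"
    and g': "continuous_on UNIV (\<lambda>z. g' (fst z) (snd z))"
    and der: "\<And>s a. ((\<lambda>s. g s a) has_vector_derivative g' s a) (at s)"
    and l: "(l has_real_derivative l') (at s)"
  shows "((\<lambda>s. LBINT a=0..l s. g s a) has_vector_derivative
      l' *\<^sub>R g s (l s) + (LBINT a=0..l s. g' s a)) (at s)"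
proof -
  define G where "G = (\<lambda>s (y::real). LBINT a=0..y. g s a)"
  have gp: "continuous_on UNIV (g p)" for p
    using continuous_on_two_args[OF g, of UNIV "\<lambda>_. p" "\<lambda>a. a"] by (simp add: continuous_intros)
  have gp': "continuous_on UNIV (g' p)" for p
    using continuous_on_two_args[OF g', of UNIV "\<lambda>_. p" "\<lambda>a. a"] by (simp add: continuous_intros)
  have int1: "((\<lambda>p. integral (cbox 0 1) (\<lambda>r. g p (y * r))) has_vector_derivative
      integral (cbox 0 1) (\<lambda>r. g' s (y * r))) (at s)" for y
    by (rule leibniz_rule_vector_derivative[where U=UNIV and fx="\<lambda>p r. g' p (y * r)"])
      (auto simp: split_beta intro!: der integrable_continuous_real continuous_intros
        continuous_on_compose2[OF gp] continuous_on_two_args[OF g'])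
  have Gx: "((\<lambda>p. G p y) has_vector_derivative (LBINT a=0..y. g' s a)) (at s)" for y
    using has_vector_derivative_scaleR[OF DERIV_const[of y] int1[of y]]
    by (simp add: G_def interval_integral_rescaled[OF gp] interval_integral_rescaled[OF gp']
        cbox_interval)
  have Gy: "((\<lambda>y. G p y) has_vector_derivative g p y) (at y)" for p y
    unfolding G_def using interval_integral_has_vector_derivative[OF gp, of 0]
    by (simp add: zero_ereal_def)
  have "((\<lambda>(p, y). G p y) has_derivative
      (\<lambda>(tx, ty). tx *\<^sub>R (LBINT a=0..l s. g' s a) + blinfun_scaleR_left (g s (l s)) ty))
      (at (s, l s) within UNIV \<times> UNIV)"
  proof (rule has_derivative_partialsI)
    show "((\<lambda>p. G p (l s)) has_derivative (\<lambda>tx. tx *\<^sub>R (LBINT a=0..l s. g' s a))) (at s)"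
      using Gx by (simp add: has_vector_derivative_def)
    show "((\<lambda>y. G p y) has_derivative blinfun_apply (blinfun_scaleR_left (g p y))) (at y)" for p y
      using Gy by (simp add: has_vector_derivative_def)
    have "continuous_on UNIV (\<lambda>(p, y). blinfun_scaleR_left (g p y))"
      unfolding split_beta by (intro continuous_intros g)
    then show "continuous (at (s, l s) within UNIV \<times> UNIV)
        (\<lambda>(p, y). blinfun_scaleR_left (g p y))"
      by (simp add: continuous_on_eq_continuous_at)
  qed auto
  then have D: "((\<lambda>(p, y). G p y) has_derivative
      (\<lambda>(tx, ty). tx *\<^sub>R (LBINT a=0..l s. g' s a) + ty *\<^sub>R g s (l s))) (at (s, l s))"
    by simp
  have P: "((\<lambda>p. (p, l p)) has_derivative (\<lambda>t. (t, t * l'))) (at s)"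
    using l by (auto intro!: derivative_eq_intros simp: has_field_derivative_def mult.commute)
  have "((\<lambda>p. G p (l p)) has_derivative
      (\<lambda>t. t *\<^sub>R (LBINT a=0..l s. g' s a) + (t * l') *\<^sub>R g s (l s))) (at s)"
    using has_derivative_compose[OF P D] by simp
  then show ?thesis
    by (simp add: has_vector_derivative_def G_def algebra_simps)
qed


section \<open>The quadratic integral of a Goursat solution\<close>

text \<open>
  The integral of \<open>K t x * K t \<tau>\<close> over \<open>t\<close> from \<open>-x\<close> to \<open>x\<close>, at \<open>x = u + v\<close>, \<open>\<tau> = u - v\<close> and after
  \<open>t = x - 2 * c\<close>; see \<open>kernel_product_eq\<close>.
\<close>

definition kernel_product :: "(real \<Rightarrow> real \<Rightarrow> complex) \<Rightarrow> real \<Rightarrow> real \<Rightarrow> complex" where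
  "kernel_product H u v = 2 * (LBINT c=0..(u + v). H (u + v - c) (-c) * H (u - c) (v - c))"

lemma interval_integral_add_continuous:
  fixes f g :: "real \<Rightarrow> complex" and a b :: real
  assumes "continuous_on UNIV f" "continuous_on UNIV g"
  shows "(LBINT t=a..b. f t + g t) = (LBINT t=a..b. f t) + (LBINT t=a..b. g t)"
  using assms
  by (intro interval_lebesgue_integral_add interval_integrable_isCont)
    (auto simp: continuous_on_eq_continuous_at)

lemma interval_integral_reflect_continuous:
  fixes g :: "real \<Rightarrow> 'a::euclidean_space" and y :: real
  assumes g: "continuous_on UNIV g"
  shows "(LBINT c=0..y. g (y - c)) = (LBINT a=0..y. g a)"
  using interval_integral_affine[OF g, of "-1" 0 y y]
    interval_integral_endpoints_reverse[of "ereal y" 0 g]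
  by (simp add: zero_ereal_def)

text \<open>
  The regularity that a Goursat solution has for merely continuous \<open>q\<close>: \<open>U\<close> is differentiable in its
  second argument only. The relation \<open>w u v = q (u + v) * H u v\<close> enters only later, as it holds just in
  the diamond for the extensions to the plane that are considered here.
\<close>

locale mixed_derivative =
  fixes H U w :: "real \<Rightarrow> real \<Rightarrow> complex" and h0 :: complex
  assumes cont_H: "continuous_on UNIV (\<lambda>z. H (fst z) (snd z))"
    and cont_U: "continuous_on UNIV (\<lambda>z. U (fst z) (snd z))"
    and cont_w: "continuous_on UNIV (\<lambda>z. w (fst z) (snd z))"
    and deriv_H: "\<And>u v. ((\<lambda>u. H u v) has_vector_derivative U u v) (at u)"
    and deriv_U: "\<And>u v. ((\<lambda>v. U u v) has_vector_derivative w u v) (at v)"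
    and H_axis: "\<And>v. H 0 v = h0"
begin

lemmas cont = continuous_on_two_args[OF cont_H] continuous_on_two_args[OF cont_U]
  continuous_on_two_args[OF cont_w]

text \<open>
  The \<open>u\<close>-derivative of \<open>kernel_product H\<close>, in the form in which each \<open>U\<close> depends on \<open>v\<close> through its
  second argument alone. For this the second integral is reflected.
\<close>

definition kernel_product_u :: "real \<Rightarrow> real \<Rightarrow> complex" where
  "kernel_product_u u v = 2 * h0 * H (-v) (-u)
    + 2 * (LBINT c=0..(u + v). H (u + v - c) (-c) * U (u - c) (v - c))
    + 2 * (LBINT a=0..(u + v). U a (a - u - v) * H (a - v) (a - u))"

lemma kernel_product_deriv:
  "((\<lambda>u. kernel_product H u v) has_vector_derivative kernel_product_u u v) (at u)"
proof -
  let ?A = "\<lambda>c. H (u + v - c) (-c) * U (u - c) (v - c)"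
  let ?B = "\<lambda>c. U (u + v - c) (-c) * H (u - c) (v - c)"
  let ?B' = "\<lambda>a. U a (a - u - v) * H (a - v) (a - u)"
  have 1: "((\<lambda>u. H (u + v - c) (-c)) has_vector_derivative U (u + v - c) (-c)) (at u)" for c u
    by (rule has_vector_derivative_eq_rhs[OF
        has_vector_derivative_chain_real[where l="\<lambda>u. u + v - c" and l'=1, OF deriv_H]])
      (auto intro!: derivative_eq_intros)
  have 2: "((\<lambda>u. H (u - c) (v - c)) has_vector_derivative U (u - c) (v - c)) (at u)" for c u
    by (rule has_vector_derivative_eq_rhs[OF
        has_vector_derivative_chain_real[where l="\<lambda>u. u - c" and l'=1, OF deriv_H]])
      (auto intro!: derivative_eq_intros)
  \<comment> \<open>The endpoint terms are the integrands with \<open>c = u + v\<close> put in, before simplification.\<close>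
  have "((\<lambda>u. LBINT c=0..(u + v). H (u + v - c) (-c) * H (u - c) (v - c)) has_vector_derivative
      1 *\<^sub>R (H (u + v - (u + v)) (-(u + v)) * H (u - (u + v)) (v - (u + v)))
      + (LBINT c=0..(u + v). ?A c + ?B c)) (at u)"
    by (rule leibniz_moving_endpoint, intro continuous_intros cont, intro continuous_intros cont,
        rule has_vector_derivative_mult[OF 1 2], auto intro!: derivative_eq_intros)
  moreover have "(LBINT c=0..(u + v). ?A c + ?B c)
      = (LBINT c=0..(u + v). ?A c) + (LBINT c=0..(u + v). ?B c)"
    unfolding zero_ereal_def
    by (rule interval_integral_add_continuous) (intro continuous_intros cont)+
  moreover have "(LBINT c=0..(u + v). ?B c) = (LBINT a=0..(u + v). ?B' a)"
    using interval_integral_reflect_continuous[of ?B' "u + v"]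
    by (simp add: continuous_intros cont)
  ultimately have "((\<lambda>u. LBINT c=0..(u + v). H (u + v - c) (-c) * H (u - c) (v - c))
      has_vector_derivative h0 * H (-v) (-u) + ((LBINT c=0..(u + v). ?A c)
        + (LBINT a=0..(u + v). ?B' a))) (at u)"
    by (simp add: H_axis)
  from has_vector_derivative_mult_right[OF this, of 2] show ?thesis
    by (simp add: kernel_product_def kernel_product_u_def algebra_simps)
qed

text \<open>
  The endpoint of the first integral contributes \<open>h0 * U (-v) (-u)\<close>, which is compensated by the
  derivative of \<open>h0 * H (-v) (-u)\<close>; the endpoint of the second contributes \<open>U (u + v) 0 * H u v\<close>.
  The second integral is reflected back after the differentiation, so that the remaining two
  integrals differ only in which factor carries \<open>w\<close>.
\<close>

lemma kernel_product_u_deriv: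
  "((\<lambda>v. kernel_product_u u v) has_vector_derivative 2 * U (u + v) 0 * H u v
    + 2 * (LBINT c=0..(u + v). U (u + v - c) (-c) * U (u - c) (v - c)
            + H (u + v - c) (-c) * w (u - c) (v - c))
    - 2 * (LBINT c=0..(u + v). U (u + v - c) (-c) * U (u - c) (v - c)
            + w (u + v - c) (-c) * H (u - c) (v - c))) (at v)"
proof -
  let ?P = "\<lambda>v c. H (u + v - c) (-c) * w (u - c) (v - c) + U (u + v - c) (-c) * U (u - c) (v - c)"
  let ?Q' = "\<lambda>a. U a (a - u - v) * U (a - v) (a - u) + w a (a - u - v) * H (a - v) (a - u)"
  have 0: "((\<lambda>v. H (-v) (-u)) has_vector_derivative - U (-v) (-u)) (at v)"
    by (rule has_vector_derivative_eq_rhs[OF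
        has_vector_derivative_chain_real[where l="\<lambda>v. - v" and l'="-1", OF deriv_H]])
      (auto intro!: derivative_eq_intros)
  have 1: "((\<lambda>v. H (u + v - c) (-c)) has_vector_derivative U (u + v - c) (-c)) (at v)" for c v
    by (rule has_vector_derivative_eq_rhs[OF
        has_vector_derivative_chain_real[where l="\<lambda>v. u + v - c" and l'=1, OF deriv_H]])
      (auto intro!: derivative_eq_intros)
  have 2: "((\<lambda>v. U (u - c) (v - c)) has_vector_derivative w (u - c) (v - c)) (at v)" for c v
    by (rule has_vector_derivative_eq_rhs[OF
        has_vector_derivative_chain_real[where l="\<lambda>v. v - c" and l'=1, OF deriv_U]])
      (auto intro!: derivative_eq_intros)
  have 3: "((\<lambda>v. U a (a - u - v)) has_vector_derivative - w a (a - u - v)) (at v)" for a v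
    by (rule has_vector_derivative_eq_rhs[OF
        has_vector_derivative_chain_real[where l="\<lambda>v. a - u - v" and l'="-1", OF deriv_U]])
      (auto intro!: derivative_eq_intros)
  have 4: "((\<lambda>v. H (a - v) (a - u)) has_vector_derivative - U (a - v) (a - u)) (at v)" for a v
    by (rule has_vector_derivative_eq_rhs[OF
        has_vector_derivative_chain_real[where l="\<lambda>v. a - v" and l'="-1", OF deriv_H]])
      (auto intro!: derivative_eq_intros)
  have P: "((\<lambda>v. LBINT c=0..(u + v). H (u + v - c) (-c) * U (u - c) (v - c)) has_vector_derivative
      1 *\<^sub>R (H (u + v - (u + v)) (-(u + v)) * U (u - (u + v)) (v - (u + v)))
      + (LBINT c=0..(u + v). ?P v c)) (at v)"
    by (rule leibniz_moving_endpoint, intro continuous_intros cont, intro continuous_intros cont,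
        rule has_vector_derivative_mult[OF 1 2], auto intro!: derivative_eq_intros)
  have "((\<lambda>v. LBINT a=0..(u + v). U a (a - u - v) * H (a - v) (a - u)) has_vector_derivative
      1 *\<^sub>R (U (u + v) (u + v - u - v) * H (u + v - v) (u + v - u))
      + (LBINT a=0..(u + v). U a (a - u - v) * (- U (a - v) (a - u))
          + (- w a (a - u - v)) * H (a - v) (a - u))) (at v)"
    by (rule leibniz_moving_endpoint, intro continuous_intros cont, intro continuous_intros cont,
        rule has_vector_derivative_mult[OF 3 4], auto intro!: derivative_eq_intros)
  moreover have "(LBINT a=0..(u + v). U a (a - u - v) * (- U (a - v) (a - u))
        + (- w a (a - u - v)) * H (a - v) (a - u))
      = - (LBINT a=0..(u + v). ?Q' a)"
    by (simp add: interval_lebesgue_integral_uminus[symmetric])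
  moreover have "(LBINT a=0..(u + v). ?Q' a)
      = (LBINT c=0..(u + v). U (u + v - c) (-c) * U (u - c) (v - c)
            + w (u + v - c) (-c) * H (u - c) (v - c))"
    using interval_integral_reflect_continuous[of ?Q' "u + v"]
    by (simp add: continuous_intros cont)
  ultimately have Q: "((\<lambda>v. LBINT a=0..(u + v). U a (a - u - v) * H (a - v) (a - u))
      has_vector_derivative U (u + v) 0 * H u v
      - (LBINT c=0..(u + v). U (u + v - c) (-c) * U (u - c) (v - c)
            + w (u + v - c) (-c) * H (u - c) (v - c))) (at v)"
    by simp
  show ?thesis
    unfolding kernel_product_u_def
    by (rule has_vector_derivative_eq_rhs,
        (rule has_vector_derivative_add has_vector_derivative_mult_right 0 P Q)+)
      (simp add: H_axis algebra_simps)
qed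

text \<open>
  The points \<open>(u + v - c, -c)\<close> and \<open>(u - c, v - c)\<close> have the same coordinate sum \<open>u + v - 2 * c\<close>, and
  for \<open>c\<close> between \<open>0\<close> and \<open>u + v\<close> both lie in the diamond. Hence \<open>q\<close> takes the same value at both, the
  two integrals of the preceding lemma agree, and \<open>kernel_product H\<close> and \<open>H\<close> have the same mixed
  derivative in the diamond. Their difference is a sum of one-variable functions, because the
  diamond contains with \<open>(u, v)\<close> the rectangle spanned by \<open>(u, v)\<close> and the origin.
\<close>

lemma kernel_product_additive:
  assumes goursat: "\<And>u v. \<bar>u\<bar> + \<bar>v\<bar> \<le> b \<Longrightarrow> w u v = q (u + v) * H u v"
    and axis: "\<And>u. \<bar>u\<bar> \<le> b \<Longrightarrow> 2 * U u 0 = q u"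
    and uv: "\<bar>u\<bar> + \<bar>v\<bar> \<le> b"
  shows "kernel_product H u v - H u v
    = (kernel_product H u 0 - H u 0) + kernel_product H 0 v"
proof -
  have dE: "((\<lambda>v. kernel_product_u u v - U u v) has_vector_derivative 0) (at v)"
    if uv: "\<bar>u\<bar> + \<bar>v\<bar> \<le> b" for u v
  proof -
    have "(LBINT c=0..(u + v). U (u + v - c) (-c) * U (u - c) (v - c)
            + H (u + v - c) (-c) * w (u - c) (v - c))
        = (LBINT c=0..(u + v). U (u + v - c) (-c) * U (u - c) (v - c)
            + w (u + v - c) (-c) * H (u - c) (v - c))"
    proof (rule interval_integral_cong)
      fix c :: real assume "c \<in> einterval (min 0 (ereal (u + v))) (max 0 (ereal (u + v)))"
      then have c: "min 0 (u + v) < c" "c < max 0 (u + v)"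
        by (auto simp: einterval_iff min_def max_def zero_ereal_def split: if_splits)
      have "w (u - c) (v - c) = q (u + v - 2 * c) * H (u - c) (v - c)"
        using c uv by (subst goursat) (auto simp: algebra_simps)
      moreover have "w (u + v - c) (-c) = q (u + v - 2 * c) * H (u + v - c) (-c)"
        using c uv by (subst goursat) (auto simp: algebra_simps)
      ultimately show "U (u + v - c) (-c) * U (u - c) (v - c)
          + H (u + v - c) (-c) * w (u - c) (v - c)
        = U (u + v - c) (-c) * U (u - c) (v - c) + w (u + v - c) (-c) * H (u - c) (v - c)"
        by simp
    qed
    moreover have "2 * U (u + v) 0 * H u v = w u v"
      using axis[of "u + v"] goursat[OF uv] uv by auto
    ultimately show ?thesis
      using has_vector_derivative_diff[OF kernel_product_u_deriv[of u v] deriv_U[of u v]] by simp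
  qed
  have E: "kernel_product_u u v - U u v = kernel_product_u u 0 - U u 0"
    if uv: "\<bar>u\<bar> + \<bar>v\<bar> \<le> b" for u v
  proof (rule has_vector_derivative_zero_on_segment)
    fix t assume "t \<in> closed_segment 0 v"
    then show "((\<lambda>v. kernel_product_u u v - U u v) has_vector_derivative 0) (at t)"
      using uv by (intro dE) (auto simp: closed_segment_eq_real_ivl split: if_splits)
  qed
  have "(kernel_product H u v - H u v) - (kernel_product H u 0 - H u 0)
      = (kernel_product H 0 v - H 0 v) - (kernel_product H 0 0 - H 0 0)"
  proof (rule has_vector_derivative_zero_on_segment[where
        \<phi> = "\<lambda>u. (kernel_product H u v - H u v) - (kernel_product H u 0 - H u 0)"])
    fix t assume "t \<in> closed_segment 0 u"
    then have "\<bar>t\<bar> + \<bar>v\<bar> \<le> b"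
      using uv by (auto simp: closed_segment_eq_real_ivl split: if_splits)
    from E[OF this]
    show "((\<lambda>u. (kernel_product H u v - H u v) - (kernel_product H u 0 - H u 0))
        has_vector_derivative 0) (at t)"
      by (intro has_vector_derivative_eq_rhs[OF has_vector_derivative_diff[OF
        has_vector_derivative_diff[OF kernel_product_deriv deriv_H]
        has_vector_derivative_diff[OF kernel_product_deriv deriv_H]]]) simp
  qed
  moreover have "kernel_product H 0 0 = 0"
    by (simp add: kernel_product_def zero_ereal_def[symmetric])
  ultimately show ?thesis by (simp add: H_axis algebra_simps)
qed

end

section \<open>Global extension of a Goursat solution\<close>

text \<open>
  The product \<open>q (u + v) * H u v\<close> is continuous on the closed diamond, so it extends to a continuous
  \<open>w\<close> on the plane, and \<open>q\<close> extends likewise to \<open>Q\<close>. Integrating \<open>w\<close> twice with the Goursat data of \<open>Q\<close>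
  gives \<open>G\<close>. In the open diamond the \<open>v\<close>-derivatives of \<open>G\<close> and \<open>H\<close> both vanish on \<open>u = 0\<close> and have
  the same \<open>u\<close>-derivative, and \<open>G\<close> and \<open>H\<close> agree on \<open>v = 0\<close>; hence \<open>G = H\<close> there.
  Equality on the boundary follows by continuity.
\<close>

lemma goursat_extension:
  assumes b: "0 < b" and q: "continuous_on {-b..b} q" and H: "goursat_solution b q h H"
  obtains G U w where "mixed_derivative G U w (h / 2)"
    "\<And>u v. \<bar>u\<bar> + \<bar>v\<bar> \<le> b \<Longrightarrow> w u v = q (u + v) * G u v"
    "\<And>u. \<bar>u\<bar> \<le> b \<Longrightarrow> 2 * U u 0 = q u"
    "\<And>u v. \<bar>u\<bar> + \<bar>v\<bar> \<le> b \<Longrightarrow> G u v = H u v"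
proof -
  have contH: "continuous_on (diamond b) (\<lambda>(u, v). H u v)"
    and H_u: "\<And>u. u \<in> {-b..b} \<Longrightarrow> H u 0 = h / 2 + 1 / 2 * (LBINT s=0..u. q s)"
    and H_v: "\<And>v. v \<in> {-b..b} \<Longrightarrow> H 0 v = h / 2"
    using H by (auto simp: goursat_solution_def)
  obtain Hv where Hv: "\<And>u v. \<bar>u\<bar> + \<bar>v\<bar> < b \<Longrightarrow> ((\<lambda>v. H u v) has_vector_derivative Hv u v) (at v)"
    and Hvu: "\<And>u v. \<bar>u\<bar> + \<bar>v\<bar> < b \<Longrightarrow>
      ((\<lambda>u. Hv u v) has_vector_derivative q (u + v) * H u v) (at u)"
    using H unfolding goursat_solution_def by blast
  have in_diamond: "(u, v) \<in> diamond b \<longleftrightarrow> \<bar>u\<bar> + \<bar>v\<bar> \<le> b" for u v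
    by (simp add: diamond_def)
  have "closed (diamond b)"
    unfolding diamond_def split_beta by (intro closed_Collect_le continuous_intros)
  moreover have "continuous_on (diamond b) (\<lambda>z. q (fst z + snd z) * H (fst z) (snd z))"
  proof (intro continuous_on_mult)
    show "continuous_on (diamond b) (\<lambda>z. q (fst z + snd z))"
      by (rule continuous_on_compose2[OF q])
        (auto simp: diamond_def intro!: continuous_intros)
    show "continuous_on (diamond b) (\<lambda>z. H (fst z) (snd z))"
      using contH by (simp add: split_beta)
  qed
  ultimately obtain w' where w': "continuous_on UNIV w'"
    "\<And>z. z \<in> diamond b \<Longrightarrow> w' z = q (fst z + snd z) * H (fst z) (snd z)"
    using Tietze_unbounded[of "diamond b" "\<lambda>z. q (fst z + snd z) * H (fst z) (snd z)" UNIV]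
    by (auto simp: closed_closedin[symmetric])
  obtain Q where Q: "continuous_on UNIV Q" "\<And>s. s \<in> {-b..b} \<Longrightarrow> Q s = q s"
    using Tietze_unbounded[of "{-b..b}" q UNIV] q by (auto simp: closed_closedin[symmetric])
  define w where "w = (\<lambda>u v. w' (u, v))"
  define U where "U = (\<lambda>u v. Q u / 2 + (LBINT \<beta>=0..ereal v. w u \<beta>))"
  define G where "G = (\<lambda>u v. h / 2 + (LBINT \<alpha>=0..ereal u. U \<alpha> v))"
  have cw: "continuous_on UNIV (\<lambda>z. w (fst z) (snd z))"
    using w'(1) by (simp add: w_def)
  note cw1 = continuous_on_two_args[OF cw]
  have cU: "continuous_on UNIV (\<lambda>z. U (fst z) (snd z))"
    unfolding U_def
    by (intro continuous_intros interval_integral_continuous_param[OF cw]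
        continuous_on_compose2[OF Q(1)]) auto
  note cU1 = continuous_on_two_args[OF cU]
  have "continuous_on UNIV (\<lambda>z. LBINT \<alpha>=0..ereal (snd z). U \<alpha> (fst z))"
    by (rule interval_integral_continuous_param[where g="\<lambda>v \<alpha>. U \<alpha> v"])
      (intro continuous_intros cU1)
  then have "continuous_on UNIV (\<lambda>z. LBINT \<alpha>=0..ereal (fst z). U \<alpha> (snd z))"
    using continuous_on_two_args[where f="\<lambda>v u. LBINT \<alpha>=0..ereal u. U \<alpha> v"
        and a=snd and b=fst and S=UNIV]
    by (simp add: continuous_intros)
  then have cG: "continuous_on UNIV (\<lambda>z. G (fst z) (snd z))"
    unfolding G_def by (intro continuous_intros)
  have dU: "((\<lambda>v. U u v) has_vector_derivative w u v) (at v)" for u v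
    using has_vector_derivative_add[OF has_vector_derivative_const
        interval_integral_has_vector_derivative[of "w u" 0 v]]
    by (simp add: U_def zero_ereal_def cw1 continuous_intros)
  have dG: "((\<lambda>u. G u v) has_vector_derivative U u v) (at u)" for u v
    using has_vector_derivative_add[OF has_vector_derivative_const
        interval_integral_has_vector_derivative[of "\<lambda>\<alpha>. U \<alpha> v" 0 u]]
    by (simp add: G_def zero_ereal_def cU1 continuous_intros)
  have G0: "G 0 v = h / 2" for v
    by (simp add: G_def zero_ereal_def[symmetric])
  have mixed: "mixed_derivative G U w (h / 2)"
    by unfold_locales (fact cG cU cw dG dU G0)+

  \<comment> \<open>\<open>U\<close> is obtained from \<open>w\<close> by integrating in \<open>v\<close>, whereas the Goursat problem speaks of the
    \<open>v\<close>-derivative of \<open>H\<close>. Differentiating \<open>G\<close> under the integral sign exchanges the order of the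
    two integrations.\<close>
  define V where "V = (\<lambda>u v. LBINT \<alpha>=0..ereal u. w \<alpha> v)"
  have dGv: "((\<lambda>v. G u v) has_vector_derivative V u v) (at v)" for u v
  proof -
    have "((\<lambda>v. LBINT \<alpha>=0..ereal u. U \<alpha> v) has_vector_derivative
        0 *\<^sub>R U u v + (LBINT \<alpha>=0..ereal u. w \<alpha> v)) (at v)"
      by (rule leibniz_moving_endpoint, intro continuous_intros cU1, intro continuous_intros cw1,
          rule dU, rule DERIV_const)
    from has_vector_derivative_add[OF has_vector_derivative_const[of "h / 2"] this]
    show ?thesis by (simp add: G_def V_def)
  qed
  have dV: "((\<lambda>u. V u v) has_vector_derivative w u v) (at u)" for u v
    using interval_integral_has_vector_derivative[of "\<lambda>\<alpha>. w \<alpha> v" 0 u]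
    by (simp add: V_def zero_ereal_def cw1 continuous_intros)
  have Hv0: "Hv 0 v = 0" if "\<bar>v\<bar> < b" for v
  proof -
    have "((\<lambda>v. H 0 v) has_vector_derivative 0) (at v)"
      by (rule has_vector_derivative_transform_within_open[of "\<lambda>_. h / 2" 0 v "{-b<..<b}"])
        (use that in \<open>auto simp: H_v\<close>)
    then show ?thesis
      using vector_derivative_unique_at[OF Hv[of 0 v]] that by simp
  qed
  have Hv_eq: "Hv u v = V u v" if uv: "\<bar>u\<bar> + \<bar>v\<bar> < b" for u v
  proof -
    have "Hv u v - V u v = Hv 0 v - V 0 v"
    proof (rule has_vector_derivative_zero_on_segment[where \<phi>="\<lambda>u. Hv u v - V u v"])
      fix t assume "t \<in> closed_segment 0 u"
      then have t: "\<bar>t\<bar> + \<bar>v\<bar> < b"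
        using uv by (auto simp: closed_segment_eq_real_ivl split: if_splits)
      then have "w t v = q (t + v) * H t v"
        using w'(2)[of "(t, v)"] by (simp add: w_def in_diamond)
      then show "((\<lambda>u. Hv u v - V u v) has_vector_derivative 0) (at t)"
        using has_vector_derivative_diff[OF Hvu[OF t] dV, of v] by simp
    qed
    then show ?thesis using Hv0[of v] uv by (simp add: V_def zero_ereal_def[symmetric])
  qed
  have axis: "G u 0 = H u 0" if "\<bar>u\<bar> \<le> b" for u
  proof -
    have "(LBINT \<alpha>=0..ereal u. U \<alpha> 0) = (LBINT \<alpha>=0..ereal u. q \<alpha> / 2)"
      by (rule interval_integral_cong)
        (use that in \<open>auto simp: U_def zero_ereal_def[symmetric] einterval_iff min_def max_def Q(2)
          split: if_splits\<close>)
    then show ?thesis using that H_u[of u] by (simp add: G_def abs_le_iff)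
  qed
  have inner: "H u v - G u v = 0" if uv: "\<bar>u\<bar> + \<bar>v\<bar> < b" for u v
  proof -
    have "H u v - G u v = H u 0 - G u 0"
    proof (rule has_vector_derivative_zero_on_segment)
      fix t assume "t \<in> closed_segment 0 v"
      then have t: "\<bar>u\<bar> + \<bar>t\<bar> < b"
        using uv by (auto simp: closed_segment_eq_real_ivl split: if_splits)
      show "((\<lambda>v. H u v - G u v) has_vector_derivative 0) (at t)"
        using has_vector_derivative_diff[OF Hv[OF t] dGv, of u] Hv_eq[OF t] by simp
    qed
    then show ?thesis using axis[of u] uv by simp
  qed
  have GH: "G u v = H u v" if uv: "\<bar>u\<bar> + \<bar>v\<bar> \<le> b" for u v
  proof -
    have bound: "\<bar>r * u\<bar> + \<bar>r * v\<bar> \<le> r * b" if "0 \<le> r" for r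
      using mult_left_mono[OF uv that] that by (simp only: abs_mult abs_of_nonneg distrib_left)
    \<comment> \<open>The ray from the origin to \<open>(u, v)\<close> lies in the open diamond except possibly for its end.\<close>
    have "continuous_on {0..1} (\<lambda>r. H (r * u) (r * v) - G (r * u) (r * v))"
    proof (intro continuous_on_diff continuous_on_two_args[OF cG] continuous_intros)
      have "(r * u, r * v) \<in> diamond b" if "r \<in> {0..1}" for r
        using bound[of r] mult_right_mono[of r 1 b] b that
        unfolding in_diamond atLeastAtMost_iff by linarith
      then have sub: "(\<lambda>r. (r * u, r * v)) ` {0..1} \<subseteq> diamond b"
        by (rule image_subsetI)
      have "continuous_on {0..1} (\<lambda>r. (r * u, r * v))"
        by (intro continuous_intros)
      from continuous_on_compose2[OF contH this sub]
      show "continuous_on {0..1} (\<lambda>r. H (r * u) (r * v))"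
        by simp
    qed
    moreover have "H (r * u) (r * v) - G (r * u) (r * v) = 0" if "r \<in> {0..<1}" for r
    proof (rule inner)
      have "r * b < b" using that b by simp
      then show "\<bar>r * u\<bar> + \<bar>r * v\<bar> < b"
        using bound[of r] that by simp
    qed
    ultimately have "H (1 * u) (1 * v) - G (1 * u) (1 * v) = 0"
      by (intro continuous_constant_on_closure[where S="{0..<1}" and x=1
            and f="\<lambda>r. H (r * u) (r * v) - G (r * u) (r * v)"]) auto
    then show ?thesis by simp
  qed
  show ?thesis
  proof (rule that[OF mixed])
    show "w u v = q (u + v) * G u v" if "\<bar>u\<bar> + \<bar>v\<bar> \<le> b" for u v
      using w'(2)[of "(u, v)"] that GH[OF that] by (simp add: w_def in_diamond)
    show "2 * U u 0 = q u" if "\<bar>u\<bar> \<le> b" for u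
      using that Q(2)[of u] by (simp add: U_def zero_ereal_def[symmetric] abs_le_iff)
  qed (fact GH)
qed

section \<open>The preimage of the transmutation kernel\<close>

lemma kernel_product_eq:
  fixes K :: "real \<Rightarrow> real \<Rightarrow> complex" and u v :: real
  assumes G: "continuous_on UNIV (\<lambda>z. G (fst z) (snd z))"
    and K: "\<And>x t. \<bar>x\<bar> \<le> b \<Longrightarrow> \<bar>t\<bar> \<le> b \<Longrightarrow> K x t = G ((x + t) / 2) ((x - t) / 2)"
    and uv: "\<bar>u\<bar> + \<bar>v\<bar> \<le> b"
  shows "(LBINT t=-(u + v)..u + v. K t (u + v) * K t (u - v)) = kernel_product G u v"
proof -
  let ?x = "u + v" and ?\<tau> = "u - v"
  let ?g = "\<lambda>t. G ((t + ?x) / 2) ((t - ?x) / 2) * G ((t + ?\<tau>) / 2) ((t - ?\<tau>) / 2)"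
  have g: "continuous_on UNIV ?g"
    by (intro continuous_intros continuous_on_two_args[OF G]) simp_all
  have "(LBINT t=-?x..?x. K t ?x * K t ?\<tau>) = (LBINT t=ereal (-?x)..ereal ?x. ?g t)"
    unfolding uminus_ereal.simps
  proof (rule interval_integral_cong)
    fix t :: real assume "t \<in> einterval (min (ereal (-?x)) (ereal ?x)) (max (ereal (-?x)) (ereal ?x))"
    then have "\<bar>t\<bar> \<le> \<bar>?x\<bar>" by (auto simp: einterval_iff min_def max_def split: if_splits)
    then show "K t ?x * K t ?\<tau> = ?g t"
      using uv by (subst (1 2) K) auto
  qed
  also have "\<dots> = - (LBINT t=ereal (-2 * 0 + ?x)..ereal (-2 * ?x + ?x). ?g t)"
    by (subst interval_integral_endpoints_reverse) simp
  also have "\<dots> = 2 *\<^sub>R (LBINT c=ereal 0..ereal ?x. ?g (-2 * c + ?x))"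
    by (subst interval_integral_affine[OF g]) simp
  also have "(\<lambda>c. ?g (-2 * c + ?x)) = (\<lambda>c. G (u + v - c) (-c) * G (u - c) (v - c))"
    by (intro ext arg_cong2[where f="(*)"] arg_cong2[where f=G]) (simp_all add: field_simps)
  finally show ?thesis by (simp add: kernel_product_def zero_ereal_def scaleR_conv_of_real)
qed

theorem proposition5p1:
  fixes b :: real and q f f' :: "real \<Rightarrow> complex" and h :: complex
    and K :: "real \<Rightarrow> real \<Rightarrow> complex" and x \<tau> :: real
  assumes "0 < b"
    and "continuous_on {-b..b} q"
    and "\<And>y. y \<in> {-b..b} \<Longrightarrow> (f has_vector_derivative f' y) (at y within {-b..b})"
    and "\<And>y. y \<in> {-b..b} \<Longrightarrow> (f' has_vector_derivative q y * f y) (at y within {-b..b})"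
    and "\<And>y. y \<in> {-b..b} \<Longrightarrow> f y \<noteq> 0"
    and "f 0 = 1"
    and "h = f' 0"
    and "transmutation_kernel b q h K"
    and "x \<in> {-b..b}" and "\<tau> \<in> {-b..b}"
  shows "kernel_preimage K x \<tau> =
      h / 2 + 1 / 2 * (LBINT s=0..(x + \<tau>) / 2. q s)
      - (LBINT t=-((x + \<tau>) / 2)..(x + \<tau>) / 2. (K t ((x + \<tau>) / 2))\<^sup>2)
      - (LBINT t=-((x - \<tau>) / 2)..(x - \<tau>) / 2. K t ((x - \<tau>) / 2) * K t (- ((x - \<tau>) / 2)))"
proof -
  define u v where "u = (x + \<tau>) / 2" and "v = (x - \<tau>) / 2"
  \<comment> \<open>Characteristic coordinates: the two integrals on the right belong to the points
    \<open>(u, 0)\<close> and \<open>(0, v)\<close>, where \<open>(x, \<tau>)\<close> becomes \<open>(u, u)\<close> and \<open>(v, -v)\<close>.\<close>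
  have x: "x = u + v" and \<tau>: "\<tau> = u - v" by (auto simp: u_def v_def field_simps)
  have uv: "\<bar>u\<bar> + \<bar>v\<bar> \<le> b"
    using assms(9,10) by (auto simp: x \<tau> abs_le_iff)
  obtain H where H: "goursat_solution b q h H"
    and KH: "\<And>x t. \<bar>x\<bar> \<le> b \<Longrightarrow> \<bar>t\<bar> \<le> b \<Longrightarrow> K x t = H ((x + t) / 2) ((x - t) / 2)"
    using assms(8) by (auto simp: transmutation_kernel_def abs_le_iff)
  obtain G U w where mixed: "mixed_derivative G U w (h / 2)"
    and w: "\<And>u v. \<bar>u\<bar> + \<bar>v\<bar> \<le> b \<Longrightarrow> w u v = q (u + v) * G u v"
    and U: "\<And>u. \<bar>u\<bar> \<le> b \<Longrightarrow> 2 * U u 0 = q u"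
    and GH: "\<And>u v. \<bar>u\<bar> + \<bar>v\<bar> \<le> b \<Longrightarrow> G u v = H u v"
    using goursat_extension[OF assms(1,2) H] by metis
  have K: "K x t = G ((x + t) / 2) ((x - t) / 2)" if "\<bar>x\<bar> \<le> b" "\<bar>t\<bar> \<le> b" for x t
  proof -
    have "\<bar>(x + t) / 2\<bar> + \<bar>(x - t) / 2\<bar> \<le> b"
      using that by (auto simp: abs_if field_simps)
    then show ?thesis using KH[OF that] GH by simp
  qed
  have product: "(LBINT t=-(u + v)..u + v. K t (u + v) * K t (u - v)) = kernel_product G u v"
    if "\<bar>u\<bar> + \<bar>v\<bar> \<le> b" for u v
    by (rule kernel_product_eq[OF mixed_derivative.cont_H[OF mixed] _ that]) (rule K)
  have Gu: "G u 0 = h / 2 + 1 / 2 * (LBINT s=0..u. q s)"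
  proof -
    have "u \<in> {-b..b}" using uv unfolding atLeastAtMost_iff by linarith
    then show ?thesis using H GH[of u 0] uv by (simp add: goursat_solution_def)
  qed
  have "kernel_preimage K x \<tau> = - (kernel_product G u v - G u v)"
    using product[OF uv] K[of x \<tau>] uv
    by (simp add: kernel_preimage_def inv_transmutation_def x \<tau>)
  also have "kernel_product G u v - G u v = kernel_product G u 0 - G u 0 + kernel_product G 0 v"
    by (rule mixed_derivative.kernel_product_additive[OF mixed w U uv])
  also have "- \<dots> = G u 0 - kernel_product G u 0 - kernel_product G 0 v"
    by simp
  also have "kernel_product G u 0 = (LBINT t=-u..u. (K t u)\<^sup>2)"
    using product[of u 0] uv by (simp add: power2_eq_square)
  also have "kernel_product G 0 v = (LBINT t=-v..v. K t v * K t (-v))"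
    using product[of 0 v] uv by simp
  also note Gu
  finally show ?thesis unfolding u_def v_def .
qed

end
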